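(* Let $n\ge 3$ and $m\ge 1$ be integers, and let $m=F_{n,c_1}+F_{n,c_2}+\cdots+F_{n,c_k}$ be the $n$-decomposition of $m$. Then $$N_{a_i}(m)=\begin{cases}F_{n,c_1-(n+i-1)}+F_{n,c_2-(n+i-1)}+\cdots+F_{n,c_k-(n+i-1)}, & \text{if }1\le i\le n-1;\\ F_{n,c_1-(n-1)}+F_{n,c_2-(n-1)}+\cdots+F_{n,c_k-(n-1)}, & \text{if } i=n.\end{cases}$$
   Context: For an integer $n\ge 2$, define $F_{n,1}=F_{n,2}=\cdots=F_{n,n}=1$ and $F_{n,m+1}=F_{n,m}+F_{n,m+1-n}$ for all $m\ge n$. The sequence is extended to nonpositive indices by requiring the same recurrence to hold for all integer indices, i.e. $F_{n,m}=F_{n,m+n}-F_{n,m+n-1}$ for $m\le 0$. The $n$-decomposition of a positive integer $m$ is its (known to exist and be unique) representation $m=\sum_{i=1}^k F_{n,c_i}$ with $k\ge 1$, $c_1\ge n$ and $c_i\ge c_{i-1}+n$ for $2\le i\le k$. Let $a_1,\dots,a_n$ be distinct letters and let $\circ$ denote concatenation of strings. Define $S_1=a_1,\dots,S_n=a_n$ (one-letter strings) and $S_m=S_{m-1}\circ S_{m-n}$ for $m\ge n+1$. For $m\ge n$, $S_m$ is a prefix of $S_{m+1}$, and $S_\infty$ (the $n$-string) is the infinite string having every $S_m$, $m\ge n$, as a prefix. For $m\ge 1$ and $1\le i\le n$, $N_{a_i}(m)$ denotes the number of occurrences of the letter $a_i$ among the first $m$ letters of $S_\infty$. *)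

theory Defs
  imports Main "HOL-Library.Stream" "HOL-Library.Sublist"
begin

text \<open>
  The numbers $F_{n,m}$ for all integer indices $m$. They can be negative for $m < 0$, hence the
  codomain. The mathematical definition is for $n \ge 2$; the value for $n < 2$ is a dummy
  that makes the recursion terminate.
\<close>

function F :: "nat \<Rightarrow> int \<Rightarrow> int" where
  "F n m =
    (if n < 2 then 0
     else if m \<le> 0 then F n (m + int n) - F n (m + int n - 1)
     else if m \<le> int n then 1
     else F n (m - 1) + F n (m - int n))"
  by auto
termination
  by (relation "Wellfounded.measure (\<lambda>(n, m). if m \<le> 0 then n + 1 + nat (- m) else nat m)") auto

declare F.simps [simp del]

lemma F_initial: "n \<ge> 2 \<Longrightarrow> 1 \<le> m \<Longrightarrow> m \<le> int n \<Longrightarrow> F n m = 1"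
  by (simp add: F.simps)

lemma F_rec:
  assumes "n \<ge> 2"
  shows "F n (m + 1) = F n m + F n (m + 1 - int n)"
proof (cases "m \<ge> int n")
  case True
  then show ?thesis using assms by (subst F.simps) simp
next
  case False
  then show ?thesis using assms F.simps[of n "m + 1 - int n"] by simp
qed

definition is_n_decomposition :: "nat \<Rightarrow> nat \<Rightarrow> nat \<Rightarrow> (nat \<Rightarrow> int) \<Rightarrow> bool" where
  "is_n_decomposition n m k c \<longleftrightarrow>
     k \<ge> 1 \<and> c 1 \<ge> int n \<and> (\<forall>i\<in>{2..k}. c i \<ge> c (i - 1) + int n) \<and>
     int m = (\<Sum>i=1..k. F n (c i))"

text \<open>
  The strings $S_m$ ($m \ge 1$) over the letters $a_i$ = \<open>a i\<close>, $1 \le i \le n$; the empty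
  string is a dummy value for $m = 0$ and for $n = 0$.
\<close>

function S :: "nat \<Rightarrow> (nat \<Rightarrow> 'a) \<Rightarrow> nat \<Rightarrow> 'a list" where
  "S n a m =
    (if n = 0 \<or> m = 0 then []
     else if m \<le> n then [a m]
     else S n a (m - 1) @ S n a (m - n))"
  by auto
termination
  by (relation "Wellfounded.measure (\<lambda>(n, a, m). m)") auto

declare S.simps [simp del]

definition stream_prefix :: "'a list \<Rightarrow> 'a stream \<Rightarrow> bool" where
  "stream_prefix xs w \<longleftrightarrow> stake (length xs) w = xs"

definition S_inf :: "nat \<Rightarrow> (nat \<Rightarrow> 'a) \<Rightarrow> 'a stream" where
  "S_inf n a = (THE w. \<forall>m\<ge>n. stream_prefix (S n a m) w)"

definition N :: "nat \<Rightarrow> (nat \<Rightarrow> 'a) \<Rightarrow> 'a \<Rightarrow> nat \<Rightarrow> nat" where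
  "N n a x m = count_list (stake m (S_inf n a)) x"

text \<open>\<open>S_inf\<close> is well defined: there is exactly one infinite string with the required prefixes.\<close>

lemma S_step: "n \<ge> 1 \<Longrightarrow> m \<ge> n \<Longrightarrow> S n a (Suc m) = S n a m @ S n a (Suc m - n)"
  by (subst S.simps) simp

lemma S_nonempty: "n \<ge> 1 \<Longrightarrow> m \<ge> 1 \<Longrightarrow> S n a m \<noteq> []"
proof (induction m rule: less_induct)
  case (less m)
  show ?case
  proof (cases "m \<le> n")
    case True
    then show ?thesis using less.prems by (subst S.simps) simp
  next
    case False
    then have "S n a (m - n) \<noteq> []" using less by simp
    then show ?thesis using False less.prems by (subst S.simps) simp
  qed
qed

lemma S_prefix: "n \<ge> 1 \<Longrightarrow> n \<le> l \<Longrightarrow> l \<le> m \<Longrightarrow> prefix (S n a l) (S n a m)"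
proof (induction m)
  case (Suc m)
  show ?case
  proof (cases "l \<le> m")
    case True
    then have "prefix (S n a l) (S n a m)" using Suc by simp
    moreover have "S n a (Suc m) = S n a m @ S n a (Suc m - n)"
      using Suc.prems True by (intro S_step) auto
    ultimately show ?thesis by simp
  next
    case False
    then have "l = Suc m" using Suc by simp
    then show ?thesis by simp
  qed
qed simp

lemma S_length: "n \<ge> 1 \<Longrightarrow> length (S n a (n + j)) > j"
proof (induction j)
  case 0
  then show ?case using S_nonempty[of n n a] by simp
next
  case (Suc j)
  have "S n a (Suc (n + j)) = S n a (n + j) @ S n a (Suc (n + j) - n)"
    using Suc.prems by (intro S_step) auto
  moreover have "S n a (Suc (n + j) - n) \<noteq> []"
    using Suc.prems by (intro S_nonempty) auto
  ultimately show ?case using Suc by (cases "S n a (Suc (n + j) - n)") auto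
qed

lemma S_inf_ex1:
  assumes "n \<ge> 1"
  shows "\<exists>!w. \<forall>m\<ge>n. stream_prefix (S n a m) w"
proof (rule ex_ex1I)
  define w where "w = smap (\<lambda>j. S n a (n + j) ! j) nats"
  have nth_eq: "S n a l ! j = S n a m ! j"
    if "n \<le> l" "n \<le> m" "j < length (S n a l)" "j < length (S n a m)" for l m j
  proof (cases "l \<le> m")
    case True
    then have "prefix (S n a l) (S n a m)" using S_prefix[OF assms] that by blast
    then show ?thesis using that by (auto simp: prefix_def nth_append)
  next
    case False
    then have "prefix (S n a m) (S n a l)" using that by (intro S_prefix[OF assms]) auto
    then show ?thesis using that by (auto simp: prefix_def nth_append)
  qed
  have "stream_prefix (S n a m) w" if "m \<ge> n" for m
    unfolding stream_prefix_def
  proof (rule nth_equalityI)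
    fix j assume "j < length (stake (length (S n a m)) w)"
    then have "j < length (S n a m)" by simp
    then show "stake (length (S n a m)) w ! j = S n a m ! j"
      using nth_eq[of "n + j" m j] S_length[OF assms, of j a] that
      by (simp add: w_def stake_nth)
  qed simp
  then show "\<exists>w. \<forall>m\<ge>n. stream_prefix (S n a m) w" by blast
next
  fix v w :: "'a stream"
  assume v: "\<forall>m\<ge>n. stream_prefix (S n a m) v" and w: "\<forall>m\<ge>n. stream_prefix (S n a m) w"
  have "v !! j = w !! j" for j
  proof -
    have "stake (length (S n a (n + j))) v = stake (length (S n a (n + j))) w"
      using v w by (simp add: stream_prefix_def)
    then show ?thesis using S_length[OF assms] by (metis stake_nth)
  qed
  then show "v = w" by (metis stream_smap_nats ext)
qed

lemma S_inf_prefix: "n \<ge> 1 \<Longrightarrow> m \<ge> n \<Longrightarrow> stream_prefix (S n a m) (S_inf n a)"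
  using theI'[OF S_inf_ex1[of n a]] unfolding S_inf_def by blast

end

theory Submission
  imports Defs
begin

text \<open>
  The decomposition of $m$ cuts the prefix of length $m$ of the $n$-string into the blocks
  $S_{c_k} \circ \cdots \circ S_{c_1}$, with the largest index first: as $c_{k-1} + 1 \le c_k + 1 - n$,
  the blocks after $S_{c_k}$ fit, by induction, into the second factor of
  $S_{c_k+1} = S_{c_k} \circ S_{c_k+1-n}$ (lemma \<open>prefix_blocks\<close>). Letter counts are additive
  over the blocks, so the theorem reduces to counting a letter in a single $S_p$.

  As functions of $p$, the length of $S_p$ and the number of its letters $a_i$ satisfy the
  recurrence of $F$, hence each is a shift of $F$ as soon as it is one on $1 \le p \le n$. For the
  count, the initial values vanish except for a $1$ at $p = i$. Running the recurrence
  backwards shows that $F$ is $0$ on $[3-2n, -n]$, $1$ at $1-n$, $0$ on $[2-n, 0]$ and $1$ at $1$.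
  For $i \le n-1$ the window of length $n$ around the isolated $1$ at $1-n$ gives the shift
  $n+i-1$. For $i = n$ this window would have to begin at $2-2n$, where $F$ is $-1$; instead the
  window that ends with the $1$ at index $1$ gives the shift $n-1$.
\<close>

lemma F_backward: "n \<ge> 2 \<Longrightarrow> F n j = F n (j + int n) - F n (j + int n - 1)"
  using F_rec[of n "j + int n - 1"] by simp

lemma F_zero_before_one:
  assumes "n \<ge> 2" "2 - int n \<le> j" "j \<le> 0"
  shows "F n j = 0"
  using assms F_backward[of n j] by (simp add: F_initial)

lemma F_one_isolated:
  assumes "n \<ge> 2"
  shows "F n (1 - int n) = 1"
  using assms F_backward[of n "1 - int n"] by (simp add: F_initial F_zero_before_one)

lemma F_zero_before_isolated_one:
  assumes "n \<ge> 2" "3 - 2 * int n \<le> j" "j \<le> - int n"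
  shows "F n j = 0"
  using assms F_backward[of n j] by (simp add: F_zero_before_one)

lemma F_shift_unique:
  fixes g :: "nat \<Rightarrow> int"
  assumes n: "n \<ge> 2"
    and init: "\<And>p. 1 \<le> p \<Longrightarrow> p \<le> n \<Longrightarrow> g p = F n (int p - d)"
    and rec: "\<And>p. p > n \<Longrightarrow> g p = g (p - 1) + g (p - n)"
    and p: "p \<ge> 1"
  shows "g p = F n (int p - d)"
  using p
proof (induction p rule: less_induct)
  case (less p)
  show ?case
  proof (cases "p \<le> n")
    case True
    then show ?thesis using init less.prems by blast
  next
    case False
    then have "g (p - 1) = F n (int p - 1 - d)" "g (p - n) = F n (int p - int n - d)"
      using less.IH[of "p - 1"] less.IH[of "p - n"] n by (auto simp: of_nat_diff)
    then show ?thesis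
      using rec[of p] False F_rec[OF n, of "int p - 1 - d"] by (simp add: algebra_simps)
  qed
qed

lemma S_initial: "1 \<le> p \<Longrightarrow> p \<le> n \<Longrightarrow> S n a p = [a p]"
  by (simp add: S.simps)

lemma S_rec: "n \<ge> 1 \<Longrightarrow> p > n \<Longrightarrow> S n a p = S n a (p - 1) @ S n a (p - n)"
  using S_step[of n "p - 1" a] by simp

lemma length_S:
  assumes "n \<ge> 2" "p \<ge> 1"
  shows "int (length (S n a p)) = F n (int p)"
  using F_shift_unique[of n "\<lambda>p. int (length (S n a p))" 0 p] assms
  by (simp add: S_initial F_initial S_rec)

lemma count_S:
  assumes n: "n \<ge> 2" and inj: "inj_on a {1..n}" and i: "i \<in> {1..n}" and p: "p \<ge> 1"
  shows "int (count_list (S n a p) (a i)) =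
    F n (int p - (if i \<le> n - 1 then int n + int i - 1 else int n - 1))"
proof (rule F_shift_unique[OF n _ _ p])
  fix q :: nat
  assume q: "1 \<le> q" "q \<le> n"
  have "a q = a i \<longleftrightarrow> q = i"
    using inj i q by (auto dest: inj_onD)
  then have count: "int (count_list (S n a q) (a i)) = (if q = i then 1 else 0)"
    using q by (simp add: S_initial)
  show "int (count_list (S n a q) (a i)) =
    F n (int q - (if i \<le> n - 1 then int n + int i - 1 else int n - 1))"
  proof (cases "i \<le> n - 1")
    case True
    consider "q < i" | "q = i" | "q > i" by linarith
    then have "F n (int q - (int n + int i - 1)) = (if q = i then 1 else 0)"
    proof cases
      case 1
      then show ?thesis using True n q by (simp add: F_zero_before_isolated_one)
    next
      case 2
      then show ?thesis using F_one_isolated[OF n] by simp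
    next
      case 3
      then show ?thesis using i n q by (simp add: F_zero_before_one)
    qed
    then show ?thesis using True count by simp
  next
    case False
    then have "i = n" using i by simp
    moreover have "F n (int q - (int n - 1)) = (if q = n then 1 else 0)"
      using n q by (simp add: F_zero_before_one F_initial)
    ultimately show ?thesis using False count by (simp only: if_False)
  qed
next
  fix q :: nat
  assume "q > n"
  then show "int (count_list (S n a q) (a i)) =
    int (count_list (S n a (q - 1)) (a i)) + int (count_list (S n a (q - n)) (a i))"
    using n by (simp add: S_rec)
qed

definition blocks :: "nat \<Rightarrow> (nat \<Rightarrow> 'a) \<Rightarrow> (nat \<Rightarrow> int) \<Rightarrow> nat \<Rightarrow> 'a list" where
  "blocks n a c k = concat (map (\<lambda>j. S n a (nat (c j))) (rev [1..<Suc k]))"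

lemma blocks_0 [simp]: "blocks n a c 0 = []"
  by (simp add: blocks_def)

lemma blocks_Suc [simp]: "blocks n a c (Suc k) = S n a (nat (c (Suc k))) @ blocks n a c k"
  by (simp add: blocks_def)

lemma length_blocks: "length (blocks n a c k) = (\<Sum>j=1..k. length (S n a (nat (c j))))"
  by (induction k) simp_all

lemma count_blocks:
  "count_list (blocks n a c k) x = (\<Sum>j=1..k. count_list (S n a (nat (c j))) x)"
  by (induction k) simp_all

lemma decomposition_index_ge:
  fixes c :: "nat \<Rightarrow> int"
  assumes "c 1 \<ge> int n" "\<forall>i\<in>{2..k}. c i \<ge> c (i - 1) + int n" "j \<in> {1..k}"
  shows "c j \<ge> int n"
  using assms(3)
proof (induction j)
  case (Suc j)
  show ?case
  proof (cases "j = 0")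
    case True
    then show ?thesis using assms(1) by simp
  next
    case False
    then have "c j \<ge> int n" "c (Suc j) \<ge> c j + int n"
      using Suc bspec[OF assms(2), of "Suc j"] by auto
    then show ?thesis by simp
  qed
qed simp

text \<open>
  The bound is the string one index above the largest block: $S_{c_k}$ itself leaves no room for
  the smaller blocks, and $S_{c_k+1}$ leaves exactly $S_{c_k+1-n}$, which the gap condition makes
  long enough to contain $S_{c_{k-1}+1}$ as a prefix.
\<close>

lemma prefix_blocks:
  assumes n: "n \<ge> 1" and c1: "c 1 \<ge> int n"
    and gap: "\<forall>i\<in>{2..k}. c i \<ge> c (i - 1) + int n" and k: "k \<ge> 1"
  shows "prefix (blocks n a c k) (S n a (Suc (nat (c k))))"
  using k gap
proof (induction k rule: nat_induct_at_least)
  case base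
  show ?case using S_prefix[of n "nat (c 1)" "Suc (nat (c 1))" a] n c1 by simp
next
  case (Suc k)
  have ck: "c k \<ge> int n"
    using decomposition_index_ge[OF c1 Suc.prems, of k] Suc.hyps by simp
  have gap_k: "c (Suc k) \<ge> c k + int n"
    using bspec[OF Suc.prems, of "Suc k"] Suc.hyps by simp
  have "prefix (blocks n a c k) (S n a (Suc (nat (c k))))"
    using Suc by simp
  also have "prefix \<dots> (S n a (Suc (nat (c (Suc k))) - n))"
    using n ck gap_k by (intro S_prefix) auto
  finally show ?case
    using S_step[of n "nat (c (Suc k))" a] n ck gap_k by simp
qed

lemma stake_eq_if_stream_prefix:
  assumes "stream_prefix ys w" "prefix xs ys"
  shows "stake (length xs) w = xs"
proof -
  obtain zs where ys: "ys = xs @ zs" using assms(2) by (auto simp: prefix_def)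
  have "stake (length xs) w = take (length xs) (stake (length ys) w)"
    by (simp add: take_stake ys min_def)
  also have "\<dots> = xs"
    using assms(1) by (simp add: stream_prefix_def ys)
  finally show ?thesis .
qed

theorem theorem1p6:
  fixes n m k :: nat and a :: "nat \<Rightarrow> 'a" and c :: "nat \<Rightarrow> int"
  assumes "n \<ge> 3" and "m \<ge> 1"
    and "inj_on a {1..n}"
    and "is_n_decomposition n m k c"
  shows "\<forall>i\<in>{1..n}. int (N n a (a i) m) =
    (if i \<le> n - 1 then (\<Sum>j=1..k. F n (c j - (int n + int i - 1)))
     else (\<Sum>j=1..k. F n (c j - (int n - 1))))"
proof
  fix i assume i: "i \<in> {1..n}"
  have n: "n \<ge> 2" using assms(1) by simp
  have k: "k \<ge> 1" and c1: "c 1 \<ge> int n"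
    and gap: "\<forall>i\<in>{2..k}. c i \<ge> c (i - 1) + int n"
    and m: "int m = (\<Sum>j=1..k. F n (c j))"
    using assms(4) by (auto simp: is_n_decomposition_def)
  have c_ge: "c j \<ge> int n" if "j \<in> {1..k}" for j
    using decomposition_index_ge[OF c1 gap that] .
  have "int (length (blocks n a c k)) = (\<Sum>j=1..k. F n (c j))"
    unfolding length_blocks of_nat_sum
  proof (rule sum.cong[OF refl])
    fix j assume "j \<in> {1..k}"
    then show "int (length (S n a (nat (c j)))) = F n (c j)"
      using c_ge[of j] n length_S[of n "nat (c j)" a] by simp
  qed
  then have "m = length (blocks n a c k)" using m by simp
  moreover have "stream_prefix (S n a (Suc (nat (c k)))) (S_inf n a)"
    using c_ge[of k] k n by (intro S_inf_prefix) auto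
  moreover have "prefix (blocks n a c k) (S n a (Suc (nat (c k))))"
    using n c1 gap k by (intro prefix_blocks) auto
  ultimately have stake: "stake m (S_inf n a) = blocks n a c k"
    using stake_eq_if_stream_prefix by blast
  have "int (N n a (a i) m) =
    (\<Sum>j=1..k. F n (c j - (if i \<le> n - 1 then int n + int i - 1 else int n - 1)))"
    unfolding N_def stake count_blocks of_nat_sum
  proof (rule sum.cong[OF refl])
    fix j assume "j \<in> {1..k}"
    then show "int (count_list (S n a (nat (c j))) (a i)) =
      F n (c j - (if i \<le> n - 1 then int n + int i - 1 else int n - 1))"
      using c_ge[of j] n count_S[OF n assms(3) i, of "nat (c j)"] by simp
  qed
  then show "int (N n a (a i) m) =
    (if i \<le> n - 1 then (\<Sum>j=1..k. F n (c j - (int n + int i - 1)))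
     else (\<Sum>j=1..k. F n (c j - (int n - 1))))"
    by simp
qed

end
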